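(* For every order $r\in\{1,2,3,\ldots\}$, on the random model $(\Omega_n,P_n)$ the $r$th bifurcation ratio satisfies \[ \sqrt{n}\left(\frac{S_{r+1,n}}{S_{r,n}}-\frac{1}{4}\right)\Rightarrow N\left(0,\,4^{r-3}\right)\qquad (n\to\infty), \] where $\Rightarrow$ denotes convergence in distribution and $N(\mu,\sigma^2)$ is the normal distribution with mean $\mu$ and variance $\sigma^2$.
   Context: For $n\ge 1$, let $\Omega_n$ be the set of rooted plane (ordered) full binary trees with $n$ leaves (every internal node has exactly two children, left and right distinguished), so $|\Omega_n|=\frac{(2n-2)!}{n!(n-1)!}$. The random model is $\Omega_n$ with the uniform probability measure $P_n$. Horton–Strahler ordering: every leaf has order 1; an internal node whose two children have different orders $r_1\neq r_2$ has order $\max\{r_1,r_2\}$; an internal node whose two children both have order $r$ has order $r+1$. A branch of order $r$ is a maximal connected path consisting of nodes all of order $r$. For $\tau\in\Omega_n$, $S_{r,n}(\tau)$ denotes the number of branches of order $r$ in $\tau$ (so $S_{1,n}=n$). The $r$th bifurcation ratio is the random variable $S_{r+1,n}/S_{r,n}$, with the convention that it equals $0$ when $S_{r,n}=0$. *)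

theory Defs
  imports "HOL-Probability.Probability"
begin

datatype tree = Leaf | Node tree tree

fun leaves :: "tree \<Rightarrow> nat" where
  "leaves Leaf = 1"
| "leaves (Node l u) = leaves l + leaves u"

definition Omega :: "nat \<Rightarrow> tree set" where
  "Omega n = {t. leaves t = n}"

fun hs :: "tree \<Rightarrow> nat" where
  "hs Leaf = 1"
| "hs (Node l u) = (if hs l = hs u then hs l + 1 else max (hs l) (hs u))"

text \<open>A branch of order r is a maximal connected set of nodes of order r; since
  a node has at most one child of its own order, it is a path, and it is
  determined by its top node: a node of order r that is the root or whose parent
  does not have order r.  sub_branch_tops r t counts such top nodes among the
  non-root nodes of t.\<close>
fun sub_branch_tops :: "nat \<Rightarrow> tree \<Rightarrow> nat" where
  "sub_branch_tops r Leaf = 0"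
| "sub_branch_tops r (Node l u) =
     (if hs l = r \<and> hs (Node l u) \<noteq> r then 1 else 0)
   + (if hs u = r \<and> hs (Node l u) \<noteq> r then 1 else 0)
   + sub_branch_tops r l + sub_branch_tops r u"

definition S :: "nat \<Rightarrow> tree \<Rightarrow> nat" where
  "S r t = (if hs t = r then 1 else 0) + sub_branch_tops r t"

definition bif_ratio :: "nat \<Rightarrow> tree \<Rightarrow> real" where
  "bif_ratio r t = (if S r t = 0 then 0 else real (S (r + 1) t) / real (S r t))"

end

theory Submission
  imports Defs "HOL-Computational_Algebra.Formal_Power_Series"
begin

text \<open>
  Deleting the leaves of a tree and contracting the resulting unary nodes lowers all Horton--Strahler
  orders by one, so the \<open>(r+1)\<close>st bifurcation ratio of a tree is the \<open>r\<close>th one of the pruned tree.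
  All trees with \<open>m\<close> leaves have the same number of preimages with \<open>n\<close> leaves, hence the pruned tree
  is uniform given its size \<open>M\<close>, and the law \<open>p\<close> of \<open>M\<close> satisfies
  \<open>4 m (m + 1) p (m + 1) = (n - 2 m) (n - 2 m - 1) p m\<close>.  Summation against a test function \<open>f\<close> gives
  the Stein identity
  \<open>E (4 M (M - 1) (f M - f (M - 1))) = E ((4 n M - n\<^sup>2 + n - 6 M) f M)\<close>,
  whose right-hand weight is affine in \<open>M\<close>.  Taking \<open>f\<close> affine bounds the variance of \<open>M\<close> by
  \<open>O(n)\<close>; taking \<open>f\<close> a character shows that the characteristic function \<open>\<phi>\<close> of
  \<open>(M - n / 4) / sqrt n\<close> satisfies \<open>\<phi>' t = - (t / 16) \<phi> t + O(1 / sqrt n)\<close>, whence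
  \<open>\<phi> t \<rightarrow> exp (- t\<^sup>2 / 32)\<close> locally uniformly.  This is the case \<open>r = 1\<close>.  Each further order
  conditions on \<open>M \<approx> n / 4\<close>, which rescales the argument of the characteristic function by 2.
\<close>

section \<open>Pruning\<close>

text \<open>Nothing would remain of a single leaf, so \<open>prune Leaf = Leaf\<close> is a default
  there; the same equation correctly turns a node with two leaf children into a leaf.\<close>

fun prune :: "tree \<Rightarrow> tree" where
  "prune Leaf = Leaf"
| "prune (Node l u) =
     (if l = Leaf then prune u else if u = Leaf then prune l else Node (prune l) (prune u))"

lemma hs_pos: "hs t \<ge> 1"
  by (induction t) auto

lemma hs_eq_1_iff: "hs t = 1 \<longleftrightarrow> t = Leaf"
proof (cases t)
  case (Node l u)
  then show ?thesis using hs_pos[of l] hs_pos[of u] by auto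
qed auto

lemma leaves_pos: "leaves t \<ge> 1"
  by (induction t) auto

text \<open>Internal nodes have order at least 2, so a leaf next to a non-leaf does not influence
  the order of the parent and contraction loses nothing.\<close>

lemma hs_prune: "t \<noteq> Leaf \<Longrightarrow> hs t = Suc (hs (prune t))"
proof (induction t)
  case (Node l u)
  then show ?case
    using hs_pos[of l] hs_pos[of u] hs_eq_1_iff[of l] hs_eq_1_iff[of u]
    by (auto simp: max_def)
qed auto

text \<open>A contracted node has the order of its non-leaf child, so that child's branch continues
  through it; a deleted leaf has order 1, which differs from \<open>Suc r\<close>.\<close>

lemma sub_branch_tops_prune:
  assumes "r \<ge> 1"
  shows "sub_branch_tops (Suc r) t = sub_branch_tops r (prune t)"
proof (induction t)
  case (Node l u)
  show ?case
    using Node assms hs_pos[of l] hs_pos[of u] hs_eq_1_iff[of l] hs_eq_1_iff[of u]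
      hs_prune[of l] hs_prune[of u]
    by (cases "l = Leaf"; cases "u = Leaf") (auto simp: max_def)
qed auto

lemma S_prune: "r \<ge> 1 \<Longrightarrow> t \<noteq> Leaf \<Longrightarrow> S (Suc r) t = S r (prune t)"
  by (simp add: S_def sub_branch_tops_prune hs_prune)

lemma bif_ratio_prune: "r \<ge> 1 \<Longrightarrow> t \<noteq> Leaf \<Longrightarrow> bif_ratio (Suc r) t = bif_ratio r (prune t)"
  by (simp add: bif_ratio_def S_prune)

lemma S_1_eq_leaves: "S 1 t = leaves t"
proof (induction t)
  case (Node l u)
  then show ?case
    using hs_pos[of l] hs_pos[of u] by (auto simp: S_def)
qed (auto simp: S_def)

lemma bif_ratio_1: "t \<noteq> Leaf \<Longrightarrow> bif_ratio 1 t = leaves (prune t) / leaves t"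
  using S_prune[of 1 t] S_1_eq_leaves[of t] S_1_eq_leaves[of "prune t"] leaves_pos[of t]
  by (simp add: bif_ratio_def)

section \<open>Counting trees by leaves\<close>

lemma finite_Omega: "finite (Omega n)"
proof (induction n rule: less_induct)
  case (less n)
  have "Omega n \<subseteq> insert Leaf (\<Union>i<n. \<Union>j<n. case_prod Node ` (Omega i \<times> Omega j))"
  proof
    fix t assume t: "t \<in> Omega n"
    show "t \<in> insert Leaf (\<Union>i<n. \<Union>j<n. case_prod Node ` (Omega i \<times> Omega j))"
    proof (cases t)
      case (Node l u)
      then have "leaves l < n" "leaves u < n"
        using t leaves_pos[of l] leaves_pos[of u] by (auto simp: Omega_def)
      then show ?thesis using Node by (force simp: Omega_def)
    qed auto
  qed
  moreover have "finite (insert Leaf (\<Union>i<n. \<Union>j<n. case_prod Node ` (Omega i \<times> Omega j)))"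
    using less by auto
  ultimately show ?case by (rule finite_subset)
qed

lemma Omega_nonempty: "n \<ge> 1 \<Longrightarrow> Omega n \<noteq> {}"
proof (induction n rule: dec_induct)
  case base
  then show ?case by (auto simp: Omega_def intro: exI[of _ Leaf])
next
  case (step n)
  then obtain t where "leaves t = n" by (auto simp: Omega_def)
  then have "Node Leaf t \<in> Omega (Suc n)" by (simp add: Omega_def)
  then show ?case by blast
qed

lemma card_Omega_pos: "n \<ge> 1 \<Longrightarrow> card (Omega n) > 0"
  by (simp add: card_gt_0_iff finite_Omega Omega_nonempty)

lemma Omega_0: "Omega 0 = {}"
proof -
  have "leaves t \<noteq> 0" for t using leaves_pos[of t] by simp
  then show ?thesis by (simp add: Omega_def)
qed

text \<open>Arbitrary sets are allowed so that the same sum and product rules serve all trees and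
  the fibres of \<open>prune\<close>.\<close>

definition tree_gf :: "tree set \<Rightarrow> real fps" where
  "tree_gf A = Abs_fps (\<lambda>n. real (card (A \<inter> Omega n)))"

lemma tree_gf_nth: "fps_nth (tree_gf A) n = real (card (A \<inter> Omega n))"
  by (simp add: tree_gf_def)

lemma tree_gf_Un: "A \<inter> B = {} \<Longrightarrow> tree_gf (A \<union> B) = tree_gf A + tree_gf B"
proof (rule fps_ext)
  fix n assume "A \<inter> B = {}"
  then have "card ((A \<inter> Omega n) \<union> (B \<inter> Omega n)) = card (A \<inter> Omega n) + card (B \<inter> Omega n)"
    by (intro card_Un_disjoint) (auto simp: finite_Omega)
  then show "fps_nth (tree_gf (A \<union> B)) n = fps_nth (tree_gf A + tree_gf B) n"
    by (simp add: tree_gf_nth Int_Un_distrib2)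
qed

lemma tree_gf_Leaf: "tree_gf {Leaf} = fps_X"
proof (rule fps_ext)
  fix n
  have "{Leaf} \<inter> Omega n = (if n = 1 then {Leaf} else {})" by (auto simp: Omega_def)
  then show "fps_nth (tree_gf {Leaf}) n = fps_nth fps_X n"
    by (simp add: tree_gf_nth)
qed

lemma tree_gf_Node: "tree_gf (case_prod Node ` (A \<times> B)) = tree_gf A * tree_gf B"
proof (rule fps_ext)
  fix n
  let ?P = "\<lambda>i. (A \<inter> Omega i) \<times> (B \<inter> Omega (n - i))"
  have eq: "case_prod Node ` (A \<times> B) \<inter> Omega n = case_prod Node ` (\<Union>i\<in>{0..n}. ?P i)"
    by (force simp: Omega_def)
  have inj: "inj_on (case_prod Node) X" for X by (auto simp: inj_on_def)
  have "card (case_prod Node ` (A \<times> B) \<inter> Omega n) = card (\<Union>i\<in>{0..n}. ?P i)"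
    unfolding eq by (rule card_image[OF inj])
  also have "\<dots> = (\<Sum>i=0..n. card (?P i))"
    by (rule card_UN_disjoint) (auto simp: finite_Omega, auto simp: Omega_def)
  finally show "fps_nth (tree_gf (case_prod Node ` (A \<times> B))) n = fps_nth (tree_gf A * tree_gf B) n"
    by (simp add: tree_gf_nth fps_mult_nth card_cartesian_product)
qed

lemma tree_gf_UNIV: "tree_gf UNIV = fps_X + (tree_gf UNIV)\<^sup>2"
proof -
  have "(UNIV :: tree set) = {Leaf} \<union> case_prod Node ` (UNIV \<times> UNIV)"
    by (auto intro: tree.exhaust simp: image_iff)
  then have "tree_gf UNIV = tree_gf ({Leaf} \<union> case_prod Node ` (UNIV \<times> UNIV))"
    by simp
  also have "\<dots> = fps_X + tree_gf UNIV * tree_gf UNIV"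
    unfolding tree_gf_Node[symmetric] tree_gf_Leaf[symmetric] by (rule tree_gf_Un) auto
  finally show ?thesis by (simp add: power2_eq_square)
qed

text \<open>Differentiating \<open>C = X + C\<^sup>2\<close> and using \<open>(1 - 2C)\<^sup>2 = 1 - 4X\<close> gives the linear
  equation \<open>(1 - 4X) C' = 1 - 2C\<close>.\<close>

lemma card_Omega_Suc:
  assumes "n \<ge> 1"
  shows "(real n + 1) * card (Omega (Suc n)) = (4 * real n - 2) * card (Omega n)"
proof -
  define C where "C = tree_gf UNIV"
  have C: "C = fps_X + C\<^sup>2" unfolding C_def by (rule tree_gf_UNIV)
  have "fps_deriv C = fps_deriv (fps_X + C\<^sup>2)" using C by simp
  then have "fps_deriv C = 1 + 2 * C * fps_deriv C"
    by (simp add: power2_eq_square algebra_simps)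
  then have d: "fps_deriv C * (1 - 2 * C) = 1" by (simp add: algebra_simps)
  have q: "1 - 4 * fps_X = (1 - 2 * C) * (1 - 2 * C)"
    using C by algebra
  have "fps_deriv C * (1 - 4 * fps_X) = (fps_deriv C * (1 - 2 * C)) * (1 - 2 * C)"
    by (simp only: q mult.assoc)
  then have "fps_deriv C * (1 - 4 * fps_X) = 1 - 2 * C"
    unfolding d by simp
  then have "fps_deriv C - 4 * (fps_X * fps_deriv C) = 1 - 2 * C"
    by (simp add: algebra_simps)
  \<comment> \<open>Comparison of coefficients at \<open>n\<close>; since \<open>n >= 1\<close>, the
    constant 1 on the right contributes nothing.\<close>
  then have "fps_nth (fps_deriv C - fps_const 4 * (fps_X * fps_deriv C)) n = fps_nth (1 - fps_const 2 * C) n"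
    by (simp add: numeral_fps_const)
  then show ?thesis using assms
    by (simp add: C_def tree_gf_nth algebra_simps)
qed

section \<open>Fibres of pruning\<close>

text \<open>Each of the \<open>2 * leaves s - 1\<close> nodes of \<open>s\<close> may have a chain
  of contracted nodes above it, each carrying a leaf on the left or on the right: a factor
  \<open>1 / (1 - 2 X)\<close> per node. Each leaf of \<open>s\<close> comes from a node with two
  leaf children: a factor \<open>X^2\<close>. Hence only \<open>leaves s\<close> matters.\<close>

lemma tree_gf_prune_fibre:
  "tree_gf {t. t \<noteq> Leaf \<and> prune t = s} * (1 - 2 * fps_X) ^ (2 * leaves s - 1)
    = fps_X ^ (2 * leaves s)"
proof -
  let ?F = "\<lambda>s. {t. t \<noteq> Leaf \<and> prune t = s}"
  let ?U = "\<lambda>s. case_prod Node ` ({Leaf} \<times> ?F s) \<union> case_prod Node ` (?F s \<times> {Leaf})"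
  \<comment> \<open>\<open>?U s\<close> collects the trees whose root is contracted,
    \<open>A \<times> B\<close> the child pairs of those whose root survives pruning. As the fibres
    exclude \<open>Leaf\<close>, a root with two leaf children is not in
    \<open>?U Leaf\<close>.\<close>
  have step: "tree_gf (?F s) * (1 - 2 * fps_X) = tree_gf (case_prod Node ` (A \<times> B))"
    if eq: "?F s = case_prod Node ` (A \<times> B) \<union> ?U s"
      and disj: "case_prod Node ` (A \<times> B) \<inter> ?U s = {}"
    for s A B
  proof -
    have "tree_gf (?F s) = tree_gf (case_prod Node ` (A \<times> B) \<union> ?U s)"
      using eq by (rule arg_cong)
    also have "\<dots> = tree_gf (case_prod Node ` (A \<times> B)) + (fps_X * tree_gf (?F s) + tree_gf (?F s) * fps_X)"
      by (subst tree_gf_Un[OF disj], subst tree_gf_Un) (auto simp: tree_gf_Leaf tree_gf_Node)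
    finally show ?thesis by (simp add: algebra_simps)
  qed
  show ?thesis
  proof (induction s)
    case Leaf
    have "?F Leaf = case_prod Node ` ({Leaf} \<times> {Leaf}) \<union> ?U Leaf"
      (is "?L = ?R")
    proof (rule set_eqI)
      show "t \<in> ?L \<longleftrightarrow> t \<in> ?R" for t by (cases t) (auto simp: image_iff)
    qed
    from step[OF this] have "tree_gf (?F Leaf) * (1 - 2 * fps_X) = tree_gf {Leaf} * tree_gf {Leaf}"
      unfolding tree_gf_Node by fastforce
    then show ?case by (simp add: tree_gf_Leaf power2_eq_square)
  next
    case (Node a b)
    have "?F (Node a b) = case_prod Node ` (?F a \<times> ?F b) \<union> ?U (Node a b)"
      (is "?L = ?R")
    proof (rule set_eqI)
      show "t \<in> ?L \<longleftrightarrow> t \<in> ?R" for t by (cases t) (auto simp: image_iff)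
    qed
    moreover have "case_prod Node ` (?F a \<times> ?F b) \<inter> ?U (Node a b) = {}"
      by auto
    ultimately have *: "tree_gf (?F (Node a b)) * (1 - 2 * fps_X) = tree_gf (?F a) * tree_gf (?F b)"
      unfolding tree_gf_Node[symmetric] by (rule step)
    have e: "2 * leaves (Node a b) - 1 = 1 + ((2 * leaves a - 1) + (2 * leaves b - 1))"
      using leaves_pos[of a] leaves_pos[of b] by simp
    have "tree_gf (?F (Node a b)) * (1 - 2 * fps_X) ^ (2 * leaves (Node a b) - 1)
        = (tree_gf (?F (Node a b)) * (1 - 2 * fps_X))
          * ((1 - 2 * fps_X) ^ (2 * leaves a - 1) * (1 - 2 * fps_X) ^ (2 * leaves b - 1))"
      unfolding e by (simp only: power_add power_one_right mult.assoc)
    also have "\<dots> = (tree_gf (?F a) * (1 - 2 * fps_X) ^ (2 * leaves a - 1))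
        * (tree_gf (?F b) * (1 - 2 * fps_X) ^ (2 * leaves b - 1))"
      unfolding * by (simp only: mult_ac)
    also have "\<dots> = fps_X ^ (2 * leaves (Node a b))"
      by (simp only: Node.IH leaves.simps distrib_left power_add)
    finally show ?case .
  qed
qed

text \<open>For \<open>m >= 1\<close> this is the coefficient of \<open>X^n\<close> in
  \<open>X^(2 m) / (1 - 2 X)^(2 m - 1)\<close>.\<close>

definition fibre_card :: "nat \<Rightarrow> nat \<Rightarrow> real" where
  "fibre_card n m = (if 2 * m \<le> n then real ((n - 2) choose (n - 2 * m)) * 2 ^ (n - 2 * m) else 0)"

lemma card_prune_fibre: "real (card {t \<in> Omega n. t \<noteq> Leaf \<and> prune t = s}) = fibre_card n (leaves s)"
proof -
  let ?F = "tree_gf {t. t \<noteq> Leaf \<and> prune t = s}" and ?m = "leaves s"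
  let ?D = "(1 - fps_const 2 * fps_X) ^ (2 * ?m - 1) :: real fps"
  have m: "2 * ?m - 1 > 0" "?m \<ge> 1" using leaves_pos[of s] by auto
  have D: "fps_nth ?D 0 \<noteq> 0" by (simp add: fps_power_zeroth)
  have "?F * ?D = fps_X ^ (2 * ?m)"
    using tree_gf_prune_fibre[of s] by (simp add: numeral_fps_const)
  then have "?F * (?D * inverse ?D) = fps_X ^ (2 * ?m) * inverse ?D"
    by (simp only: mult.assoc[symmetric])
  then have "?F = fps_X ^ (2 * ?m) * inverse ?D"
    unfolding inverse_mult_eq_1'[OF D] by simp
  then have "fps_nth ?F n = fps_nth (fps_X ^ (2 * ?m) * Abs_fps (\<lambda>k. of_nat ((2 * ?m - 1 + k - 1) choose k) * 2 ^ k)) n"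
    unfolding one_minus_const_fps_X_neg_power'[OF m(1)] by simp
  then have "fps_nth ?F n = fibre_card n ?m"
    using m by (auto simp: fps_X_power_mult_nth fibre_card_def numeral_2_eq_2)
  moreover have "{t. t \<noteq> Leaf \<and> prune t = s} \<inter> Omega n = {t \<in> Omega n. t \<noteq> Leaf \<and> prune t = s}"
    by auto
  ultimately show ?thesis by (simp add: tree_gf_nth)
qed

text \<open>The lower binomial index changes by 2, so the absorption identity is used twice; the
  change in the power of 2 gives the remaining factor 4.\<close>

lemma fibre_card_Suc:
  assumes "m \<ge> 1"
  shows "8 * real m * (2 * real m - 1) * fibre_card n (Suc m)
    = (real n - 2 * real m) * (real n - 2 * real m - 1) * fibre_card n m"
proof (cases "2 * m + 2 \<le> n")
  case True
  define j where "j = n - 2 * m - 2"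
  have n: "n = 2 * m + 2 + j" using True by (simp add: j_def)
  have "Suc j * (Suc (j + (2 * m - 1)) choose Suc j) = Suc (2 * m - 1) * (Suc (j + (2 * m - 1)) choose j)"
    by (rule Suc_times_binomial_add)
  then have "Suc j * ((2 * m + j) choose Suc j) = 2 * m * ((2 * m + j) choose j)"
    using assms by (simp add: add.commute)
  then have 1: "real (Suc j) * real ((2 * m + j) choose Suc j) = 2 * real m * real ((2 * m + j) choose j)"
    by (metis of_nat_mult of_nat_numeral)
  have "Suc (Suc j) * (Suc (Suc j + (2 * m - 2)) choose Suc (Suc j)) = Suc (2 * m - 2) * (Suc (Suc j + (2 * m - 2)) choose Suc j)"
    by (rule Suc_times_binomial_add)
  moreover have e: "Suc (Suc j + (2 * m - 2)) = 2 * m + j" "Suc (2 * m - 2) = 2 * m - 1" using assms by auto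
  ultimately have "Suc (Suc j) * ((2 * m + j) choose Suc (Suc j)) = (2 * m - 1) * ((2 * m + j) choose Suc j)"
    by (simp only: e)
  then have 2: "real (Suc (Suc j)) * real ((2 * m + j) choose Suc (Suc j)) = (2 * real m - 1) * real ((2 * m + j) choose Suc j)"
    using assms by (simp only: of_nat_mult[symmetric]) (simp add: of_nat_diff)
  have "8 * real m * (2 * real m - 1) * fibre_card n (Suc m)
      = 4 * 2 ^ j * (2 * real m - 1) * (2 * real m * real ((2 * m + j) choose j))"
    by (simp add: fibre_card_def n)
  also have "\<dots> = 4 * 2 ^ j * real (Suc j) * ((2 * real m - 1) * real ((2 * m + j) choose Suc j))"
    unfolding 1[symmetric] by simp
  also have "\<dots> = 4 * 2 ^ j * real (Suc j) * (real (Suc (Suc j)) * real ((2 * m + j) choose Suc (Suc j)))"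
    unfolding 2 ..
  also have "\<dots> = (real n - 2 * real m) * (real n - 2 * real m - 1) * fibre_card n m"
    by (simp add: fibre_card_def n)
  finally show ?thesis .
next
  case False
  \<comment> \<open>Here \<open>fibre_card n (Suc m) = 0\<close>; on the right
    \<open>fibre_card n m\<close> vanishes in the first case, and one of the two linear factors in
    the others.\<close>
  then consider "n < 2 * m" | "n = 2 * m" | "n = 2 * m + 1" by linarith
  then show ?thesis by cases (auto simp: fibre_card_def)
qed

section \<open>Law of the size of the pruned tree\<close>

text \<open>For \<open>n >= 2\<close>, the probability that a uniform tree with \<open>n\<close>
  leaves prunes to a tree with \<open>m\<close> leaves.\<close>

definition prune_weight :: "nat \<Rightarrow> nat \<Rightarrow> real" where
  "prune_weight n m = fibre_card n m * card (Omega m) / card (Omega n)"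

lemma prune_weight_nonneg: "prune_weight n m \<ge> 0"
  by (simp add: prune_weight_def fibre_card_def)

lemma prune_weight_eq_0: "2 * m > n \<Longrightarrow> prune_weight n m = 0"
  by (simp add: prune_weight_def fibre_card_def)

lemma prune_weight_0: "prune_weight n 0 = 0"
  by (simp add: prune_weight_def Omega_0)

text \<open>The factor \<open>4 * m - 2\<close> of the recursion for \<open>card (Omega m)\<close>
  is the \<open>2 * (2 * m - 1)\<close> needed by the recursion for
  \<open>fibre_card\<close>.\<close>

lemma prune_weight_Suc:
  "4 * real m * (real m + 1) * prune_weight n (Suc m)
    = (real n - 2 * real m) * (real n - 2 * real m - 1) * prune_weight n m"
proof (cases "m \<ge> 1")
  case True
  let ?a = "fibre_card n" and ?c = "\<lambda>m. real (card (Omega m))"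
  have "4 * real m * (real m + 1) * (?a (Suc m) * ?c (Suc m))
      = 4 * real m * ?a (Suc m) * ((real m + 1) * ?c (Suc m))"
    by (simp add: mult_ac)
  also have "\<dots> = 8 * real m * (2 * real m - 1) * ?a (Suc m) * ?c m"
    unfolding card_Omega_Suc[OF True] by (simp add: algebra_simps)
  also have "\<dots> = (real n - 2 * real m) * (real n - 2 * real m - 1) * (?a m * ?c m)"
    unfolding fibre_card_Suc[OF True] by simp
  finally show ?thesis
    unfolding prune_weight_def times_divide_eq_right by (rule arg_cong)
next
  case False
  then have "m = 0" by simp
  then show ?thesis by (simp add: prune_weight_0)
qed

text \<open>Expectation under the uniform measure; its value at \<open>n = 0\<close> is 0, by
  division by zero.\<close>

definition tree_avg :: "(tree \<Rightarrow> complex) \<Rightarrow> nat \<Rightarrow> complex" where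
  "tree_avg F n = (\<Sum>t\<in>Omega n. F t) / of_nat (card (Omega n))"

lemma leaves_prune_le: "leaves (prune t) \<le> leaves t"
  by (induction t) auto

lemma tree_avg_cong: "(\<And>t. leaves t = n \<Longrightarrow> F t = G t) \<Longrightarrow> tree_avg F n = tree_avg G n"
  by (simp add: tree_avg_def Omega_def)

lemma tree_avg_const: "n \<ge> 1 \<Longrightarrow> tree_avg (\<lambda>_. c) n = c"
  using card_Omega_pos[of n] by (simp add: tree_avg_def)

lemma norm_tree_avg_le:
  assumes "\<And>t. norm (F t) \<le> 1"
  shows "norm (tree_avg F n) \<le> 1"
proof -
  have "norm (\<Sum>t\<in>Omega n. F t) \<le> of_nat (card (Omega n)) * 1"
    using assms by (intro sum_norm_bound)
  then show ?thesis
    by (cases "card (Omega n) = 0") (auto simp: tree_avg_def norm_divide divide_le_eq)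
qed

text \<open>Disintegration over the pruned tree \<open>s\<close>, then over its size: fibres depend
  only on \<open>leaves s\<close>, so \<open>s\<close> is uniform given its size.
  \<open>n >= 2\<close> keeps the default value of \<open>prune\<close> out.\<close>

lemma tree_avg_prune:
  assumes "n \<ge> 2"
  shows "tree_avg (\<lambda>t. F (prune t)) n = (\<Sum>m\<le>n. of_real (prune_weight n m) * tree_avg F m)"
proof -
  let ?U = "\<Union>m\<le>n. Omega m"
  have nl: "t \<noteq> Leaf" if "t \<in> Omega n" for t using that assms by (auto simp: Omega_def)
  have "(\<Sum>t\<in>Omega n. F (prune t)) = (\<Sum>s\<in>?U. \<Sum>t | t \<in> Omega n \<and> prune t = s. F (prune t))"
  proof (rule sum.group[symmetric])
    show "prune ` Omega n \<subseteq> ?U" using leaves_prune_le by (auto simp: Omega_def)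
  qed (auto simp: finite_Omega)
  also have "\<dots> = (\<Sum>s\<in>?U. of_real (fibre_card n (leaves s)) * F s)"
  proof (rule sum.cong[OF refl])
    fix s
    have "{t. t \<in> Omega n \<and> prune t = s} = {t \<in> Omega n. t \<noteq> Leaf \<and> prune t = s}"
      using nl by auto
    then show "(\<Sum>t | t \<in> Omega n \<and> prune t = s. F (prune t)) = of_real (fibre_card n (leaves s)) * F s"
      by (simp flip: card_prune_fibre)
  qed
  also have "\<dots> = (\<Sum>m\<le>n. \<Sum>s\<in>Omega m. of_real (fibre_card n (leaves s)) * F s)"
    by (rule sum.UNION_disjoint) (auto simp: finite_Omega, auto simp: Omega_def)
  also have "\<dots> = (\<Sum>m\<le>n. of_real (fibre_card n m) * (\<Sum>s\<in>Omega m. F s))"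
    by (intro sum.cong refl) (simp add: sum_distrib_left Omega_def)
  also have "\<dots> = (\<Sum>m\<le>n. of_real (fibre_card n m) * of_nat (card (Omega m)) * tree_avg F m)"
    by (intro sum.cong refl) (use card_Omega_pos Omega_0 in \<open>force simp: tree_avg_def card_eq_0_iff finite_Omega\<close>)
  finally show ?thesis
    by (simp add: tree_avg_def[of _ n] prune_weight_def sum_divide_distrib)
qed

lemma sum_prune_weight:
  assumes "n \<ge> 2"
  shows "(\<Sum>m\<le>n. prune_weight n m) = 1"
proof -
  have "of_real (\<Sum>m\<le>n. prune_weight n m) = (\<Sum>m\<le>n. of_real (prune_weight n m) * tree_avg (\<lambda>_. 1) m)"
    unfolding of_real_sum
  proof (intro sum.cong refl)
    show "of_real (prune_weight n m) = of_real (prune_weight n m) * tree_avg (\<lambda>_. 1) m" for m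
      by (cases "m \<ge> 1") (auto simp: tree_avg_const prune_weight_0 not_less_eq_eq)
  qed
  also have "\<dots> = 1"
    using tree_avg_prune[OF assms, of "\<lambda>_. 1"] assms by (simp add: tree_avg_const)
  finally show ?thesis by (metis of_real_eq_1_iff)
qed

section \<open>Stein's identity for the size of the pruned tree\<close>

text \<open>Summation by parts with the recursion for \<open>prune_weight\<close>; the terms
  quadratic in \<open>m\<close> cancel. Values in a real vector space cover both affine functions
  and complex characters.\<close>

lemma prune_weight_stein:
  fixes f :: "real \<Rightarrow> 'a::real_vector"
  shows "(\<Sum>m\<le>n. (prune_weight n m * (4 * real m * (real m - 1))) *\<^sub>R (f m - f (real m - 1)))
    = (\<Sum>m\<le>n. (prune_weight n m * (4 * real n * m - (real n)\<^sup>2 + n - 6 * real m)) *\<^sub>R f m)"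
proof -
  let ?w = "prune_weight n"
  define g where "g m = (?w m * (4 * real m * (real m - 1))) *\<^sub>R f (real m - 1)" for m :: nat
  \<comment> \<open>\<open>g\<close> vanishes at \<open>Suc n\<close> because of the weight and at 0
    because of the factor \<open>m\<close>, so the index shift leaves no boundary terms.\<close>
  have "(\<Sum>m\<le>n. g m) = (\<Sum>m\<le>Suc n. g m)"
    by (simp add: g_def prune_weight_eq_0)
  also have "\<dots> = (\<Sum>m\<le>n. g (Suc m))"
    unfolding sum.atMost_Suc_shift by (simp add: g_def)
  also have "\<dots> = (\<Sum>m\<le>n. (?w m * ((real n - 2 * real m) * (real n - 2 * real m - 1))) *\<^sub>R f m)"
  proof (intro sum.cong refl)
    fix m
    have "?w (Suc m) * (4 * real (Suc m) * (real (Suc m) - 1)) = ?w m * ((real n - 2 * real m) * (real n - 2 * real m - 1))"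
      using prune_weight_Suc[of m n] by (simp add: algebra_simps)
    then show "g (Suc m) = (?w m * ((real n - 2 * real m) * (real n - 2 * real m - 1))) *\<^sub>R f m"
      by (simp only: g_def) simp
  qed
  finally have "(\<Sum>m\<le>n. (?w m * (4 * real m * (real m - 1))) *\<^sub>R f m) - (\<Sum>m\<le>n. g m)
      = (\<Sum>m\<le>n. (?w m * (4 * real m * (real m - 1))
          - ?w m * ((real n - 2 * real m) * (real n - 2 * real m - 1))) *\<^sub>R f m)"
    by (simp add: sum_subtractf scaleR_left_diff_distrib)
  also have "\<dots> = (\<Sum>m\<le>n. (?w m * (4 * real n * m - (real n)\<^sup>2 + n - 6 * real m)) *\<^sub>R f m)"
    by (intro sum.cong refl arg_cong2[where f = scaleR]) (simp add: algebra_simps power2_eq_square)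
  finally show ?thesis
    by (simp add: g_def sum_subtractf scaleR_right_diff_distrib)
qed

text \<open>The Stein weight is \<open>4 * n * (m - n / 4) - (6 * m - n)\<close>. For
  \<open>f v = v - n / 4\<close>, whose increments are 1, the identity expresses
  \<open>4 * n\<close> times the second moment about \<open>n / 4\<close> through terms of order
  \<open>n^2\<close>.\<close>

lemma prune_weight_variance:
  assumes "n \<ge> 2"
  shows "(\<Sum>m\<le>n. prune_weight n m * (real m - n / 4)\<^sup>2) \<le> 3 / 8 * n"
proof -
  let ?w = "prune_weight n"
  have "4 * n * (\<Sum>m\<le>n. ?w m * (real m - n / 4)\<^sup>2)
      = (\<Sum>m\<le>n. ?w m * (4 * real n * m - (real n)\<^sup>2 + n - 6 * real m) * (real m - n / 4))
        + (\<Sum>m\<le>n. ?w m * ((6 * real m - real n) * (real m - n / 4)))"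
    unfolding sum_distrib_left sum.distrib[symmetric]
    by (intro sum.cong refl) (simp add: algebra_simps power2_eq_square)
  also have "\<dots> = (\<Sum>m\<le>n. ?w m * (4 * real m * (real m - 1) + (6 * real m - real n) * (real m - n / 4)))"
    using prune_weight_stein[of n "\<lambda>v. v - n / 4"] by (simp add: sum.distrib distrib_left)
  also have "\<dots> \<le> (\<Sum>m\<le>n. ?w m * (3 / 2 * (real n)\<^sup>2))"
  proof (intro sum_mono)
    fix m
    show "?w m * (4 * real m * (real m - 1) + (6 * real m - real n) * (real m - n / 4)) \<le> ?w m * (3 / 2 * (real n)\<^sup>2)"
    proof (cases "2 * m \<le> n")
      case True
      then have le: "2 * real m \<le> real n" by linarith
      \<comment> \<open>The bracket equals \<open>10 * m^2 - 4 * m - 5/2 * m * n + n^2 / 4\<close>;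
        using \<open>2 * m <= n\<close> twice bounds it by \<open>3/2 * n^2\<close>.\<close>
      have "real m * real m * 2 \<le> real m * n" "real m * real n * 2 \<le> real n * n"
        using mult_left_mono[OF le, of "real m"] mult_right_mono[OF le, of "real n"] by (simp_all add: algebra_simps)
      then have "4 * real m * (real m - 1) + (6 * real m - real n) * (real m - n / 4) \<le> 3 / 2 * (real n)\<^sup>2"
        by (simp add: algebra_simps power2_eq_square)
      then show ?thesis by (intro mult_left_mono prune_weight_nonneg)
    qed (simp add: prune_weight_eq_0)
  qed
  also have "\<dots> = 3 / 2 * (real n)\<^sup>2"
    unfolding sum_distrib_right[symmetric] sum_prune_weight[OF assms] by simp
  finally show ?thesis using assms by (simp add: power2_eq_square)
qed

text \<open>Second moment bound combined with \<open>2 * a * b <= a^2 + b^2\<close> for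
  \<open>a = \<bar>m - n / 4\<bar>\<close> and \<open>b = sqrt n\<close>.\<close>

lemma prune_weight_mean_abs_deviation:
  assumes "n \<ge> 2"
  shows "(\<Sum>m\<le>n. prune_weight n m * \<bar>real m - n / 4\<bar>) \<le> sqrt n"
proof -
  let ?w = "prune_weight n"
  have s: "sqrt n > 0" "sqrt n * sqrt n = real n" using assms by auto
  have "(\<Sum>m\<le>n. ?w m * \<bar>real m - n / 4\<bar>)
      \<le> (\<Sum>m\<le>n. ?w m * ((real m - n / 4)\<^sup>2 / sqrt n + sqrt n) / 2)"
  proof (intro sum_mono)
    fix m
    have "0 \<le> (\<bar>real m - n / 4\<bar> - sqrt n)\<^sup>2" by simp
    then have "2 * \<bar>real m - n / 4\<bar> * sqrt n \<le> (real m - n / 4)\<^sup>2 + sqrt n * sqrt n"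
      by (simp add: power2_diff)
    then have "\<bar>real m - n / 4\<bar> \<le> ((real m - n / 4)\<^sup>2 / sqrt n + sqrt n) / 2"
      using s(1) by (simp add: pos_le_divide_eq divide_add_eq_iff del: real_sqrt_mult_self)
    from mult_left_mono[OF this prune_weight_nonneg[of n m]]
    show "?w m * \<bar>real m - n / 4\<bar> \<le> ?w m * ((real m - n / 4)\<^sup>2 / sqrt n + sqrt n) / 2" by simp
  qed
  also have "\<dots> = ((\<Sum>m\<le>n. ?w m * (real m - n / 4)\<^sup>2) / sqrt n + (\<Sum>m\<le>n. ?w m) * sqrt n) / 2"
    by (simp add: sum_divide_distrib sum_distrib_right sum.distrib add_divide_distrib distrib_left)
  also have "\<dots> \<le> (3 / 8 * n / sqrt n + sqrt n) / 2"
    unfolding sum_prune_weight[OF assms] mult_1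
    by (intro divide_right_mono add_right_mono prune_weight_variance assms) auto
  also have "3 / 8 * n / sqrt n = 3 / 8 * sqrt n"
    using s by (simp add: field_simps)
  also have "(3 / 8 * sqrt n + sqrt n) / 2 \<le> sqrt n"
    by simp
  finally show ?thesis .
qed

section \<open>Gaussian approximation for the size of the pruned tree\<close>

definition prune_char :: "nat \<Rightarrow> real \<Rightarrow> complex" where
  "prune_char n t = (\<Sum>m\<le>n. of_real (prune_weight n m) * iexp (t * ((real m - n / 4) / sqrt n)))"

definition prune_char' :: "nat \<Rightarrow> real \<Rightarrow> complex" where
  "prune_char' n t = (\<Sum>m\<le>n. of_real (prune_weight n m) *
     (\<i> * of_real ((real m - n / 4) / sqrt n) * iexp (t * ((real m - n / 4) / sqrt n))))"

lemma prune_char_deriv: "(prune_char n has_vector_derivative prune_char' n t) (at t within A)"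
proof -
  have iexp: "((\<lambda>t. iexp (t * x)) has_vector_derivative \<i> * of_real x * iexp (t * x)) (at t within A)" for x
  proof -
    have "((\<lambda>z. exp (\<i> * (z * of_real x))) has_field_derivative \<i> * of_real x * iexp (t * x)) (at (of_real t))"
      by (auto intro!: derivative_eq_intros)
    from has_vector_derivative_real_field[OF this] show ?thesis by simp
  qed
  show ?thesis
    unfolding prune_char_def[abs_def] prune_char'_def
    by (intro has_vector_derivative_sum has_vector_derivative_mult_right iexp)
qed

text \<open>Stein's identity for the character \<open>e\<close>, whose increment is
  \<open>e m * (1 - iexp (- u))\<close> with \<open>u = t / sqrt n\<close>. To leading order this is
  \<open>\<i> * u * e m\<close>, and \<open>4 * m * (m - 1)\<close> is close to
  \<open>n^2 / 4\<close> near \<open>m = n / 4\<close>, which produces the coefficient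
  \<open>t / 16\<close>.\<close>

lemma prune_char_approx_ode:
  assumes "n \<ge> 2"
  shows "norm (prune_char' n t + of_real (t / 16) * prune_char n t)
    \<le> (t\<^sup>2 / 2 + 5 * \<bar>t\<bar> + 2) / (4 * sqrt n)"
proof -
  let ?w = "prune_weight n"
  define s where "s = sqrt n"
  define u where "u = t / s"
  define e where "e v = iexp (t * ((v - n / 4) / s))" for v :: real
  have s: "s \<ge> 1" "s * s = real n" using assms by (auto simp: s_def)
  define q where "q m = 4 * real m * (real m - 1)" for m :: nat
  \<comment> \<open>The three error sources: Taylor remainder of the increment, deviation of
    \<open>q m\<close> from \<open>n^2 / 4\<close>, and the lower-order part of the Stein
    weight.\<close>
  define D where "D m = of_real (q m) * (1 - iexp (- u) - \<i> * of_real u)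
    + of_real ((q m - (real n)\<^sup>2 / 4) * u) * \<i> - of_real (real n - 6 * real m)" for m :: nat
  have norm_e: "norm (e v) = 1" for v by (simp add: e_def)
  have e_shift: "e (v - 1) = e v * iexp (- u)" for v
    by (simp add: e_def u_def exp_add[symmetric] algebra_simps diff_divide_distrib add_divide_distrib)
  have nu: "(real n)\<^sup>2 * u = n * s * t"
    using s by (simp add: u_def power2_eq_square field_simps)
  have "of_real (4 * n * s) * (prune_char' n t + of_real (t / 16) * prune_char n t)
      = \<i> * (\<Sum>m\<le>n. of_real (?w m) * (of_real (4 * n * (real m - n / 4)) - \<i> * of_real (n * s * t / 4)) * e m)"
    unfolding prune_char_def prune_char'_def sum_distrib_left sum.distrib[symmetric]
    by (intro sum.cong refl) (use s in \<open>simp add: e_def s_def[symmetric] field_simps\<close>)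
  also have "(\<Sum>m\<le>n. of_real (?w m) * (of_real (4 * n * (real m - n / 4)) - \<i> * of_real (n * s * t / 4)) * e m)
      = (\<Sum>m\<le>n. (?w m * (4 * real n * m - (real n)\<^sup>2 + n - 6 * real m)) *\<^sub>R e m)
        - (\<Sum>m\<le>n. of_real (?w m) * (of_real (real n - 6 * real m) + \<i> * of_real ((real n)\<^sup>2 * u / 4)) * e m)"
    unfolding sum_subtractf[symmetric] nu
    by (intro sum.cong refl) (simp add: scaleR_conv_of_real algebra_simps power2_eq_square)
  also have "\<dots> = (\<Sum>m\<le>n. of_real (?w m) * (e m * D m))"
    unfolding prune_weight_stein[of n e, symmetric] unfolding sum_subtractf[symmetric] e_shift
    by (intro sum.cong refl) (simp add: scaleR_conv_of_real D_def q_def algebra_simps)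
  finally have main: "of_real (4 * n * s) * (prune_char' n t + of_real (t / 16) * prune_char n t)
      = \<i> * (\<Sum>m\<le>n. of_real (?w m) * (e m * D m))" .
  have u2: "norm (1 - iexp (- u) - \<i> * of_real u) \<le> u\<^sup>2 / 2"
    using iexp_approx1[of "- u" 1] by (simp add: norm_minus_commute algebra_simps power2_eq_square)
  have D: "norm (D m) \<le> (real n)\<^sup>2 * (u\<^sup>2 / 2) + (3 * n * \<bar>real m - n / 4\<bar> + 2 * n) * \<bar>u\<bar> + 2 * n"
    if m: "2 * m \<le> n" for m
  proof -
    have le: "2 * real m \<le> n" using m by linarith
    have q0: "q m \<ge> 0" by (cases m) (auto simp: q_def)
    have "(2 * real m) * (2 * real m) \<le> real n * real n" using le by (intro mult_mono) auto
    then have q1: "q m \<le> (real n)\<^sup>2" by (simp add: q_def algebra_simps power2_eq_square)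
    \<comment> \<open>The factor \<open>m - n / 4\<close> is isolated, so that after averaging its
      mean absolute deviation bound gains a factor \<open>sqrt n\<close>.\<close>
    have "q m - (real n)\<^sup>2 / 4 = 4 * (real m - n / 4) * (real m + n / 4) - 4 * m"
      by (simp add: q_def algebra_simps power2_eq_square)
    then have "\<bar>q m - (real n)\<^sup>2 / 4\<bar> \<le> \<bar>4 * (real m - n / 4) * (real m + n / 4)\<bar> + \<bar>4 * real m\<bar>"
      by linarith
    also have "\<bar>4 * (real m - n / 4) * (real m + n / 4)\<bar> = \<bar>real m - n / 4\<bar> * (4 * (real m + n / 4))"
      using abs_of_nonneg[of "real m + n / 4"] by (simp only: abs_mult)
    also have "\<dots> \<le> \<bar>real m - n / 4\<bar> * (3 * n)" using le by (intro mult_left_mono) auto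
    finally have q2: "\<bar>q m - (real n)\<^sup>2 / 4\<bar> \<le> 3 * n * \<bar>real m - n / 4\<bar> + 2 * n"
      using le by (simp add: mult_ac)
    have "norm (D m) \<le> q m * norm (1 - iexp (- u) - \<i> * of_real u)
        + \<bar>q m - (real n)\<^sup>2 / 4\<bar> * \<bar>u\<bar> + \<bar>real n - 6 * real m\<bar>"
      unfolding D_def
      by (rule norm_triangle_le_diff, rule add_mono, rule norm_triangle_le)
        (use q0 in \<open>auto simp: norm_mult abs_mult simp del: of_real_diff of_real_mult of_real_divide\<close>)
    also have "q m * norm (1 - iexp (- u) - \<i> * of_real u) \<le> (real n)\<^sup>2 * (u\<^sup>2 / 2)"
      using q0 q1 u2 by (intro mult_mono) auto
    also have "\<bar>q m - (real n)\<^sup>2 / 4\<bar> * \<bar>u\<bar> \<le> (3 * n * \<bar>real m - n / 4\<bar> + 2 * n) * \<bar>u\<bar>"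
      using q2 by (intro mult_right_mono) auto
    also have "\<bar>real n - 6 * real m\<bar> \<le> 2 * n" using le by linarith
    finally show ?thesis by simp
  qed
  have "4 * n * s * norm (prune_char' n t + of_real (t / 16) * prune_char n t)
      = norm (\<Sum>m\<le>n. of_real (?w m) * (e m * D m))"
    using arg_cong[OF main, of norm] s by (simp add: norm_mult)
  also have "\<dots> \<le> (\<Sum>m\<le>n. ?w m * norm (D m))"
    by (rule order_trans[OF norm_sum]) (simp add: norm_mult norm_e prune_weight_nonneg)
  also have "\<dots> \<le> (\<Sum>m\<le>n. ?w m * ((real n)\<^sup>2 * (u\<^sup>2 / 2) + (3 * n * \<bar>real m - n / 4\<bar> + 2 * n) * \<bar>u\<bar> + 2 * n))"
  proof (intro sum_mono)
    fix m
    show "?w m * norm (D m) \<le> ?w m * ((real n)\<^sup>2 * (u\<^sup>2 / 2) + (3 * n * \<bar>real m - n / 4\<bar> + 2 * n) * \<bar>u\<bar> + 2 * n)"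
      using mult_left_mono[OF D prune_weight_nonneg, of m n]
      by (cases "2 * m \<le> n") (simp_all add: prune_weight_eq_0)
  qed
  also have "\<dots> = (\<Sum>m\<le>n. ?w m) * ((real n)\<^sup>2 * (u\<^sup>2 / 2) + 2 * n * \<bar>u\<bar> + 2 * n)
      + (3 * n * \<bar>u\<bar>) * (\<Sum>m\<le>n. ?w m * \<bar>real m - n / 4\<bar>)"
    unfolding sum_distrib_left sum_distrib_right sum.distrib[symmetric]
    by (intro sum.cong refl) (simp add: algebra_simps)
  also have "\<dots> \<le> ((real n)\<^sup>2 * (u\<^sup>2 / 2) + 2 * n * \<bar>u\<bar> + 2 * n) + (3 * n * \<bar>u\<bar>) * s"
    using prune_weight_mean_abs_deviation[OF assms]
    by (simp add: sum_prune_weight[OF assms] s_def mult_left_mono)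
  also have "\<dots> \<le> n * (t\<^sup>2 / 2 + 5 * \<bar>t\<bar> + 2)"
  proof -
    have us: "\<bar>u\<bar> * s = \<bar>t\<bar>" using s by (simp add: u_def abs_divide)
    then have "3 * n * \<bar>u\<bar> * s = 3 * n * \<bar>t\<bar>" by (simp only: mult.assoc)
    moreover have "(real n)\<^sup>2 * (u\<^sup>2 / 2) = n * (t\<^sup>2 / 2)"
      using s by (simp add: u_def power2_eq_square field_simps)
    moreover have "real n * \<bar>u\<bar> \<le> n * \<bar>t\<bar>"
      using mult_left_mono[OF s(1), of "\<bar>u\<bar>"] us by (intro mult_left_mono) auto
    ultimately show ?thesis unfolding distrib_left by linarith
  qed
  finally have "n * (4 * s * norm (prune_char' n t + of_real (t / 16) * prune_char n t)) \<le> n * (t\<^sup>2 / 2 + 5 * \<bar>t\<bar> + 2)"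
    by (simp add: mult_ac)
  then have "4 * s * norm (prune_char' n t + of_real (t / 16) * prune_char n t) \<le> t\<^sup>2 / 2 + 5 * \<bar>t\<bar> + 2"
    using assms by (simp only: mult_le_cancel_left_pos of_nat_0_less_iff)
  then show ?thesis
    using s unfolding s_def by (simp add: pos_le_divide_eq mult_ac)
qed

text \<open>With the integrating factor \<open>exp (x^2 / 32)\<close> the derivative of
  \<open>h\<close> consists of the error term alone; the mean value inequality on
  \<open>[-K, K]\<close> and \<open>h 0 = 1\<close> give the bound.\<close>

lemma prune_char_approx_gauss:
  assumes "n \<ge> 2" and t: "\<bar>t\<bar> \<le> K"
  shows "norm (prune_char n t - of_real (exp (- t\<^sup>2 / 32)))
    \<le> K * (exp (K\<^sup>2 / 32) * (K\<^sup>2 / 2 + 5 * K + 2) / 4) / sqrt n"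
proof -
  define h where "h x = complex_of_real (exp (x\<^sup>2 / 32)) * prune_char n x" for x
  define B where "B = exp (K\<^sup>2 / 32) * ((K\<^sup>2 / 2 + 5 * K + 2) / (4 * sqrt n))"
  let ?d = "\<lambda>x. complex_of_real (exp (x\<^sup>2 / 32)) * (prune_char' n x + of_real (x / 16) * prune_char n x)"
  have K: "K \<ge> 0" using t by linarith
  have g: "((\<lambda>x. complex_of_real (exp (x\<^sup>2 / 32)))
      has_vector_derivative of_real (exp (x\<^sup>2 / 32) * (x / 16))) (at x within A)" for x A
    by (intro has_vector_derivative_of_real)
      (auto intro!: derivative_eq_intros
        simp: has_real_derivative_iff_has_vector_derivative[symmetric])
  have deriv: "(h has_vector_derivative ?d x) (at x within A)" for x A
    unfolding h_def[abs_def]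
    by (rule has_vector_derivative_eq_rhs[OF has_vector_derivative_mult[OF g prune_char_deriv]])
      (simp add: algebra_simps)
  have bound: "norm (?d x) \<le> B" if "x \<in> {-K..K}" for x
  proof -
    have x: "\<bar>x\<bar> \<le> K" using that by auto
    then have x2: "x\<^sup>2 \<le> K\<^sup>2" using K abs_le_square_iff[of x K] by simp
    have "norm (prune_char' n x + of_real (x / 16) * prune_char n x) \<le> (x\<^sup>2 / 2 + 5 * \<bar>x\<bar> + 2) / (4 * sqrt n)"
      by (rule prune_char_approx_ode[OF assms(1)])
    also have "\<dots> \<le> (K\<^sup>2 / 2 + 5 * K + 2) / (4 * sqrt n)"
      using x x2 by (intro divide_right_mono) auto
    finally show ?thesis
      unfolding B_def norm_mult using x2 by (intro mult_mono) auto
  qed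
  have "norm (h t - h 0) \<le> B * norm (t - 0)"
  proof (rule differentiable_bound[of "{-K..K}" h "\<lambda>x y. y *\<^sub>R ?d x"])
    show "(h has_derivative (\<lambda>y. y *\<^sub>R ?d x)) (at x within {-K..K})" for x
      using deriv[of x "{-K..K}"] by (simp add: has_vector_derivative_def)
    show "onorm (\<lambda>y. y *\<^sub>R ?d x) \<le> B" if "x \<in> {-K..K}" for x
      using bound[OF that] by (intro onorm_le) (simp add: mult.commute[of B] mult_left_mono)
  qed (use t K in auto)
  also have "\<dots> \<le> B * K" using t K by (intro mult_left_mono) (auto simp: B_def)
  finally have hb: "norm (h t - 1) \<le> B * K"
    using sum_prune_weight[OF assms(1)] by (simp add: h_def prune_char_def flip: of_real_sum)
  have "prune_char n t - of_real (exp (- t\<^sup>2 / 32)) = of_real (exp (- t\<^sup>2 / 32)) * (h t - 1)"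
    by (simp add: h_def right_diff_distrib mult.assoc[symmetric] exp_add[symmetric] flip: of_real_mult)
  then have "norm (prune_char n t - of_real (exp (- t\<^sup>2 / 32))) = exp (- t\<^sup>2 / 32) * norm (h t - 1)"
    by (simp add: norm_mult)
  also have "\<dots> \<le> 1 * norm (h t - 1)" by (intro mult_right_mono) auto
  finally show ?thesis using hb by (simp add: B_def mult_ac)
qed

section \<open>Characteristic functions of the bifurcation ratios\<close>

definition bif_char :: "nat \<Rightarrow> nat \<Rightarrow> real \<Rightarrow> complex" where
  "bif_char r n t = tree_avg (\<lambda>T. iexp (t * (sqrt n * (bif_ratio r T - 1 / 4)))) n"

lemma norm_bif_char_le: "norm (bif_char r n t) \<le> 1"
  unfolding bif_char_def by (rule norm_tree_avg_le) simp

lemma bif_char_1: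
  assumes "n \<ge> 2"
  shows "bif_char 1 n t = prune_char n t"
proof -
  have "bif_char 1 n t = tree_avg (\<lambda>T. iexp (t * (sqrt n * (leaves (prune T) / n - 1 / 4)))) n"
    unfolding bif_char_def
  proof (rule tree_avg_cong)
    fix T assume T: "leaves T = n"
    then have "T \<noteq> Leaf" using assms by auto
    then show "iexp (t * (sqrt n * (bif_ratio 1 T - 1 / 4))) = iexp (t * (sqrt n * (leaves (prune T) / n - 1 / 4)))"
      using T by (simp add: bif_ratio_1 del: One_nat_def)
  qed
  also have "\<dots> = (\<Sum>m\<le>n. of_real (prune_weight n m) * tree_avg (\<lambda>s. iexp (t * (sqrt n * (leaves s / n - 1 / 4)))) m)"
    by (rule tree_avg_prune[OF assms])
  also have "\<dots> = prune_char n t"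
    unfolding prune_char_def
  proof (intro sum.cong refl)
    fix m
    have "s * (real m / (s * s) - 1 / 4) = (real m - s * s / 4) / s" if "s > 0" for s
      using that by (simp add: field_simps)
    from this[of "sqrt n"] have x: "sqrt n * (real m / n - 1 / 4) = (real m - n / 4) / sqrt n"
      using assms by simp
    show "of_real (prune_weight n m) * tree_avg (\<lambda>s. iexp (t * (sqrt n * (leaves s / n - 1 / 4)))) m
        = of_real (prune_weight n m) * iexp (t * ((real m - n / 4) / sqrt n))"
    proof (cases "m \<ge> 1")
      case True
      have "tree_avg (\<lambda>s. iexp (t * (sqrt n * (leaves s / n - 1 / 4)))) m
          = tree_avg (\<lambda>s. iexp (t * ((real m - n / 4) / sqrt n))) m"
        by (rule tree_avg_cong) (simp only: x)
      then show ?thesis using True by (simp only: tree_avg_const)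
    next
      case False
      then have "m = 0" by simp
      then show ?thesis by (simp add: prune_weight_0)
    qed
  qed
  finally show ?thesis .
qed

text \<open>Given size \<open>m\<close>, the natural scaling of the pruned tree's ratio is
  \<open>sqrt m\<close>; rewriting \<open>sqrt n\<close> as \<open>sqrt m / sqrt (m / n)\<close>
  moves the discrepancy into the argument.\<close>

lemma bif_char_Suc:
  assumes "n \<ge> 2" "r \<ge> 1"
  shows "bif_char (Suc r) n t = (\<Sum>m\<le>n. of_real (prune_weight n m) * bif_char r m (t / sqrt (m / n)))"
proof -
  have "bif_char (Suc r) n t = tree_avg (\<lambda>T. iexp (t * (sqrt n * (bif_ratio r (prune T) - 1 / 4)))) n"
    unfolding bif_char_def
  proof (rule tree_avg_cong)
    fix T assume T: "leaves T = n"
    then have "T \<noteq> Leaf" using assms by auto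
    then show "iexp (t * (sqrt n * (bif_ratio (Suc r) T - 1 / 4))) = iexp (t * (sqrt n * (bif_ratio r (prune T) - 1 / 4)))"
      using assms(2) by (simp add: bif_ratio_prune)
  qed
  also have "\<dots> = (\<Sum>m\<le>n. of_real (prune_weight n m) * tree_avg (\<lambda>s. iexp (t * (sqrt n * (bif_ratio r s - 1 / 4)))) m)"
    by (rule tree_avg_prune[OF assms(1)])
  also have "\<dots> = (\<Sum>m\<le>n. of_real (prune_weight n m) * bif_char r m (t / sqrt (m / n)))"
  proof (intro sum.cong refl)
    fix m :: nat
    have "t / sqrt (m / n) * sqrt m = t * sqrt n" if "m \<ge> 1"
      using that assms by (simp add: real_sqrt_divide)
    then have "t / sqrt (m / n) * (sqrt m * y) = t * (sqrt n * y)" if "m \<ge> 1" for y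
      using that by (simp only: mult.assoc[symmetric])
    then have "tree_avg (\<lambda>s. iexp (t * (sqrt n * (bif_ratio r s - 1 / 4)))) m = bif_char r m (t / sqrt (m / n))"
      if "m \<ge> 1"
      using that by (simp only: bif_char_def)
    then show "of_real (prune_weight n m) * tree_avg (\<lambda>s. iexp (t * (sqrt n * (bif_ratio r s - 1 / 4)))) m
        = complex_of_real (prune_weight n m) * bif_char r m (t / sqrt (m / n))"
      using prune_weight_0[of n] by (cases "m = 0") auto
  qed
  finally show ?thesis .
qed

lemma prune_weight_chebyshev:
  assumes "n \<ge> 2" "\<eta> > 0"
  shows "(\<Sum>m\<le>n. prune_weight n m * of_bool (\<bar>real m / n - 1 / 4\<bar> \<ge> \<eta>)) \<le> 3 / (8 * \<eta>\<^sup>2 * n)"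
proof -
  have "(\<eta> * n)\<^sup>2 * (\<Sum>m\<le>n. prune_weight n m * of_bool (\<bar>real m / n - 1 / 4\<bar> \<ge> \<eta>))
      \<le> (\<Sum>m\<le>n. prune_weight n m * (real m - n / 4)\<^sup>2)"
    unfolding sum_distrib_left
  proof (intro sum_mono)
    fix m
    have "(\<eta> * n)\<^sup>2 \<le> (real m - n / 4)\<^sup>2" if "\<bar>real m / n - 1 / 4\<bar> \<ge> \<eta>"
    proof -
      have "\<eta> * n \<le> \<bar>real m / n - 1 / 4\<bar> * n" using that by (intro mult_right_mono) auto
      also have "\<dots> = \<bar>real m - n / 4\<bar>" using assms by (simp add: abs_mult_pos left_diff_distrib)
      finally have "(\<eta> * n)\<^sup>2 \<le> \<bar>real m - n / 4\<bar>\<^sup>2" using assms by (intro power_mono) auto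
      then show ?thesis by simp
    qed
    then show "(\<eta> * n)\<^sup>2 * (prune_weight n m * of_bool (\<bar>real m / n - 1 / 4\<bar> \<ge> \<eta>))
        \<le> prune_weight n m * (real m - n / 4)\<^sup>2"
      using prune_weight_nonneg[of n m] by (auto simp: mult.commute[of "(\<eta> * n)\<^sup>2"] mult_left_mono)
  qed
  also have "\<dots> \<le> 3 / 8 * n" by (rule prune_weight_variance[OF assms(1)])
  finally show ?thesis using assms by (simp add: field_simps power2_eq_square)
qed

text \<open>Convergence is locally uniform in \<open>t\<close>: conditioning on the size \<open>m\<close> of the pruned tree
  rescales the argument by \<open>sqrt (n / m)\<close>, which is only close to its limit 2.\<close>

lemma bif_char_tendsto:
  assumes "r \<ge> 1" "\<epsilon> > 0"
  shows "\<exists>\<delta>>0. \<exists>N. \<forall>n\<ge>N. \<forall>s. \<bar>s - t\<bar> < \<delta> \<longrightarrow>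
    norm (bif_char r n s - of_real (exp (- (t\<^sup>2 * 4 powr (real r - 3)) / 2))) < \<epsilon>"
  using assms
proof (induction r arbitrary: t \<epsilon> rule: nat_induct_at_least)
  case base
  \<comment> \<open>All \<open>s\<close> within distance 1 of \<open>t\<close> lie in
    \<open>[-K, K]\<close>, so one rate \<open>C / sqrt n\<close> serves them all.\<close>
  define K where "K = \<bar>t\<bar> + 1"
  define C where "C = K * (exp (K\<^sup>2 / 32) * (K\<^sup>2 / 2 + 5 * K + 2) / 4)"
  let ?g = "\<lambda>s. complex_of_real (exp (- s\<^sup>2 / 32))"
  have "isCont ?g t" by (intro continuous_intros) auto
  then obtain d where d: "d > 0" "\<And>s. \<bar>s - t\<bar> < d \<Longrightarrow> norm (?g s - ?g t) < \<epsilon> / 2"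
    using base(1) unfolding continuous_at_eps_delta dist_norm by (metis half_gt_zero real_norm_def)
  have "(\<lambda>n. C / sqrt (real n)) \<longlonglongrightarrow> 0"
    by (intro real_tendsto_divide_at_top[OF tendsto_const] filterlim_compose[OF sqrt_at_top] filterlim_real_sequentially)
  then have "\<forall>\<^sub>F n in sequentially. C / sqrt (real n) < \<epsilon> / 2"
    using base(1) by (intro order_tendstoD(2)[of _ 0]) auto
  then obtain N where N: "\<And>n. n \<ge> N \<Longrightarrow> C / sqrt (real n) < \<epsilon> / 2"
    by (auto simp: eventually_sequentially)
  have lim: "?g t = of_real (exp (- (t\<^sup>2 * 4 powr (real 1 - 3)) / 2))"
    by (simp add: powr_minus powr_numeral)
  show ?case
  proof (rule exI[of _ "min d 1"], rule conjI, simp add: d, rule exI[of _ "max N 2"], intro allI impI)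
    fix n s assume n: "max N 2 \<le> n" and s: "\<bar>s - t\<bar> < min d 1"
    have "\<bar>s\<bar> \<le> K" using s unfolding K_def by linarith
    then have "norm (bif_char 1 n s - ?g s) \<le> C / sqrt n"
      using n prune_char_approx_gauss[of n s K] by (simp add: bif_char_1 C_def del: One_nat_def)
    then have "norm (bif_char 1 n s - ?g s) < \<epsilon> / 2" using N[of n] n by linarith
    moreover have "norm (?g s - ?g t) < \<epsilon> / 2" using d s by simp
    ultimately have "norm (bif_char 1 n s - ?g t) < \<epsilon>"
      by (rule norm_diff_triangle_less[THEN order_less_le_trans]) simp
    then show "norm (bif_char 1 n s - of_real (exp (- (t\<^sup>2 * 4 powr (real 1 - 3)) / 2))) < \<epsilon>"
      unfolding lim .
  qed
next
  case (Suc r)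
  let ?L = "complex_of_real (exp (- (t\<^sup>2 * 4 powr (real (Suc r) - 3)) / 2))"
  \<comment> \<open>Quadrupling the variance is the same as doubling the argument, so the induction
    hypothesis is used at \<open>2 * t\<close>.\<close>
  have "4 powr (real (Suc r) - 3) = 4 * 4 powr (real r - 3)"
    using powr_add[of 4 1 "real r - 3"] by (simp add: algebra_simps)
  then have L: "?L = of_real (exp (- ((2 * t)\<^sup>2 * 4 powr (real r - 3)) / 2))"
    by (simp add: power_mult_distrib mult_ac)
  obtain \<delta> M where \<delta>: "\<delta> > 0"
    and M: "\<And>m s. m \<ge> M \<Longrightarrow> \<bar>s - 2 * t\<bar> < \<delta> \<Longrightarrow> norm (bif_char r m s - ?L) < \<epsilon> / 2"
    using Suc.IH[of "\<epsilon> / 2" "2 * t"] Suc.prems unfolding L by auto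
  have "isCont (\<lambda>z. fst z / sqrt (snd z)) (t, 1 / 4 :: real)"
    by (intro continuous_intros) auto
  then obtain \<eta>0 where \<eta>0: "\<eta>0 > 0"
    "\<And>z. dist z (t, 1 / 4) < \<eta>0 \<Longrightarrow> dist (fst z / sqrt (snd z)) (t / sqrt (1 / 4)) < \<delta>"
    using \<delta> unfolding continuous_at_eps_delta by (metis fst_conv snd_conv)
  \<comment> \<open>Half of \<open>\<eta>0\<close> for each coordinate; \<open>1 / 8\<close> forces
    \<open>m > n / 8\<close> for sizes near \<open>n / 4\<close>, hence \<open>m >= M\<close> once
    \<open>n >= 8 * M\<close>.\<close>
  define \<eta> where "\<eta> = min (\<eta>0 / 2) (1 / 8)"
  have \<eta>: "\<eta> > 0" "\<eta> \<le> 1 / 8" "\<eta> \<le> \<eta>0 / 2" using \<eta>0 by (auto simp: \<eta>_def)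
  have close: "\<bar>s / sqrt x - 2 * t\<bar> < \<delta>" if "\<bar>s - t\<bar> < \<eta>" "\<bar>x - 1 / 4\<bar> < \<eta>" for s x
  proof -
    have "dist (s, x) (t, 1 / 4) \<le> dist s t + dist x (1 / 4)"
      unfolding dist_prod_def by (rule order_trans[OF sqrt_sum_squares_le_sum_abs]) simp
    then have "dist (s, x) (t, 1 / 4) < \<eta>0" using that \<eta>(3) by (simp add: dist_real_def)
    from \<eta>0(2)[OF this] show ?thesis by (simp add: dist_real_def real_sqrt_divide mult.commute)
  qed
  have "(\<lambda>n. (3 / (4 * \<eta>\<^sup>2)) / real n) \<longlonglongrightarrow> 0"
    by (intro real_tendsto_divide_at_top[OF tendsto_const] filterlim_real_sequentially)
  then have "\<forall>\<^sub>F n in sequentially. (3 / (4 * \<eta>\<^sup>2)) / real n < \<epsilon> / 2"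
    using Suc.prems by (intro order_tendstoD(2)[of _ 0]) auto
  then obtain N where N: "\<And>n. n \<ge> N \<Longrightarrow> (3 / (4 * \<eta>\<^sup>2)) / real n < \<epsilon> / 2"
    by (auto simp: eventually_sequentially)
  have normL: "norm ?L \<le> 1" by simp
  show ?case
  proof (rule exI[of _ \<eta>], rule conjI, rule \<eta>(1), rule exI[of _ "max N (max 2 (8 * M))"], intro allI impI)
    fix n s assume "max N (max 2 (8 * M)) \<le> n" and s: "\<bar>s - t\<bar> < \<eta>"
    then have n: "n \<ge> N" "n \<ge> 2" "n \<ge> 8 * M" by auto
    let ?w = "prune_weight n" and ?b = "\<lambda>m. bif_char r m (s / sqrt (m / n))"
    let ?far = "\<lambda>m. of_bool (\<bar>real m / n - 1 / 4\<bar> \<ge> \<eta>) :: real"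
    \<comment> \<open>Near sizes use the induction hypothesis; far sizes use the trivial bound 2 and
      are rare by Chebyshev.\<close>
    have bound: "norm (?b m - ?L) \<le> \<epsilon> / 2 + 2 * ?far m" for m
    proof (cases "\<bar>real m / n - 1 / 4\<bar> \<ge> \<eta>")
      case True
      have "norm (?b m - ?L) \<le> norm (?b m) + norm ?L" by (rule norm_triangle_ineq4)
      also have "\<dots> \<le> 2" using norm_bif_char_le[of r m "s / sqrt (m / n)"] normL by linarith
      finally show ?thesis using True Suc.prems by simp
    next
      case False
      then have "real m / n > 1 / 8" using \<eta>(2) by linarith
      then have "real m > n / 8" using n(2) by (simp add: field_simps)
      then have "m \<ge> M" using n(3) by linarith
      then show ?thesis using M[of m] close[OF s] False by (simp add: less_imp_le)
    qed
    have "bif_char (Suc r) n s - ?L = (\<Sum>m\<le>n. of_real (?w m) * ?b m) - of_real (\<Sum>m\<le>n. ?w m) * ?L"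
      using n Suc.hyps by (simp add: bif_char_Suc sum_prune_weight)
    also have "\<dots> = (\<Sum>m\<le>n. of_real (?w m) * (?b m - ?L))"
      by (simp only: of_real_sum sum_distrib_right sum_subtractf[symmetric] right_diff_distrib)
    finally have "norm (bif_char (Suc r) n s - ?L) \<le> (\<Sum>m\<le>n. norm (of_real (?w m) * (?b m - ?L)))"
      by (simp only: norm_sum)
    also have "\<dots> \<le> (\<Sum>m\<le>n. ?w m * (\<epsilon> / 2 + 2 * ?far m))"
      by (intro sum_mono) (simp only: norm_mult norm_of_real abs_of_nonneg prune_weight_nonneg mult_left_mono bound)
    also have "\<dots> = (\<Sum>m\<le>n. ?w m) * (\<epsilon> / 2) + 2 * (\<Sum>m\<le>n. ?w m * ?far m)"
      unfolding sum_distrib_left sum_distrib_right sum.distrib[symmetric]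
      by (intro sum.cong refl) (simp only: distrib_left mult_ac)
    also have "\<dots> \<le> \<epsilon> / 2 + 2 * (3 / (8 * \<eta>\<^sup>2 * n))"
      using prune_weight_chebyshev[OF n(2) \<eta>(1)] by (simp only: sum_prune_weight[OF n(2)])
    also have "2 * (3 / (8 * \<eta>\<^sup>2 * n)) = (3 / (4 * \<eta>\<^sup>2)) / real n" by simp
    also have "\<epsilon> / 2 + \<dots> < \<epsilon>" using N[OF n(1)] by linarith
    finally show "norm (bif_char (Suc r) n s - ?L) < \<epsilon>" .
  qed
qed

section \<open>From characteristic functions to weak convergence\<close>

text \<open>Scaling by \<open>\<sigma>\<close> maps the standard normal law to this one.\<close>

lemma char_normal:
  assumes "\<sigma> > 0"
  shows "char (density lborel (normal_density 0 \<sigma>)) t = of_real (exp (- (t\<^sup>2 * \<sigma>\<^sup>2) / 2))"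
proof -
  interpret std: prob_space std_normal_distribution by (rule prob_space_normal_density) simp
  have "distributed std_normal_distribution lborel (\<lambda>x. x) std_normal_density"
    by (auto simp: distributed_def distr_id2)
  from std.normal_density_affine[OF this, of \<sigma> 0]
  have "distr std_normal_distribution lborel (\<lambda>x. \<sigma> * x) = density lborel (normal_density 0 \<sigma>)"
    using assms by (simp add: distributed_def)
  moreover have "distr std_normal_distribution lborel (\<lambda>x. \<sigma> * x)
      = distr std_normal_distribution borel (\<lambda>x. \<sigma> * x)"
    by (rule distr_cong) auto
  ultimately have "char (density lborel (normal_density 0 \<sigma>)) t
      = char (distr std_normal_distribution borel (\<lambda>x. \<sigma> * x)) t"
    by simp
  also have "\<dots> = char std_normal_distribution (t * \<sigma>)"
    unfolding char_def by (subst integral_distr) (auto simp: mult_ac)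
  finally have "char (density lborel (normal_density 0 \<sigma>)) t = char std_normal_distribution (t * \<sigma>)" .
  then show ?thesis
    by (simp add: char_std_normal_distribution power_mult_distrib)
qed

theorem theorem2:
  fixes r :: nat
  assumes "r \<ge> 1"
  shows "weak_conv_m
           (\<lambda>n. distr (measure_pmf (pmf_of_set (Omega n))) borel
                  (\<lambda>t. sqrt (real n) * (bif_ratio r t - 1 / 4)))
           (density lborel (normal_density 0 (sqrt (4 powr (real r - 3)))))"
proof (rule levy_continuity)
  show "real_distribution (distr (measure_pmf (pmf_of_set (Omega n))) borel
      (\<lambda>t. sqrt (real n) * (bif_ratio r t - 1 / 4)))" for n
    by (rule prob_space.real_distribution_distr[OF measure_pmf.prob_space_axioms]) simp
  show "real_distribution (density lborel (normal_density 0 (sqrt (4 powr (real r - 3)))))"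
    by (intro real_distribution.intro prob_space_normal_density real_distribution_axioms.intro) auto
  fix t
  have "(\<lambda>n. bif_char r n t) \<longlonglongrightarrow> of_real (exp (- (t\<^sup>2 * 4 powr (real r - 3)) / 2))"
  proof (rule LIMSEQ_I)
    fix \<epsilon> :: real assume "\<epsilon> > 0"
    from bif_char_tendsto[OF assms this, of t] obtain \<delta> N where "\<delta> > 0"
      and "\<And>n s. n \<ge> N \<Longrightarrow> \<bar>s - t\<bar> < \<delta> \<Longrightarrow>
        norm (bif_char r n s - of_real (exp (- (t\<^sup>2 * 4 powr (real r - 3)) / 2))) < \<epsilon>"
      by blast
    then show "\<exists>N. \<forall>n\<ge>N. norm (bif_char r n t - of_real (exp (- (t\<^sup>2 * 4 powr (real r - 3)) / 2))) < \<epsilon>"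
      by (intro exI[of _ N]) simp
  qed
  \<comment> \<open>Only eventually: \<open>Omega 0\<close> is empty, so
    \<open>pmf_of_set (Omega 0)\<close> is not a uniform law.\<close>
  moreover have ev: "\<forall>\<^sub>F n in sequentially. char (distr (measure_pmf (pmf_of_set (Omega n))) borel
      (\<lambda>t. sqrt (real n) * (bif_ratio r t - 1 / 4))) t = bif_char r n t"
    using eventually_ge_at_top[of 1]
  proof eventually_elim
    case (elim n)
    note Omega = Omega_nonempty[OF elim] finite_Omega[of n]
    have "char (distr (measure_pmf (pmf_of_set (Omega n))) borel (\<lambda>t. sqrt (real n) * (bif_ratio r t - 1 / 4))) t
        = (LINT T|measure_pmf (pmf_of_set (Omega n)). iexp (t * (sqrt n * (bif_ratio r T - 1 / 4))))"
      unfolding char_def by (subst integral_distr) auto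
    also have "\<dots> = (\<Sum>T\<in>Omega n. pmf (pmf_of_set (Omega n)) T *\<^sub>R iexp (t * (sqrt n * (bif_ratio r T - 1 / 4))))"
      by (rule integral_measure_pmf) (auto simp: Omega)
    also have "\<dots> = bif_char r n t"
      unfolding bif_char_def tree_avg_def sum_divide_distrib
      by (intro sum.cong refl) (simp add: Omega scaleR_conv_of_real)
    finally show ?case .
  qed
  ultimately show "(\<lambda>n. char (distr (measure_pmf (pmf_of_set (Omega n))) borel
      (\<lambda>t. sqrt (real n) * (bif_ratio r t - 1 / 4))) t)
    \<longlonglongrightarrow> char (density lborel (normal_density 0 (sqrt (4 powr (real r - 3))))) t"
    unfolding tendsto_cong[OF ev] by (simp add: char_normal)
qed

end
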